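(* For every fixed $\epsilon>0$ there exists $d_0=d_0(\epsilon)$ such that for every fixed integer $d\ge d_0$, asymptotically almost surely $G\in\mathcal{G}_{n,d}$ contains no $q$-bipartite hole with $q\ge(1+\epsilon)\frac{2n\log d}{d}$. As a consequence, a.a.s. \[ Z(G)\ge n\left(1-(1+\epsilon)\frac{4\log d}{d}\right). \]
   Context: $\mathcal{G}_{n,d}$ denotes the uniform probability space of (simple) $d$-regular graphs on $n$ labelled vertices, with $d$ fixed, $n\to\infty$, and $n$ even if $d$ is odd; a.a.s. means with probability tending to $1$ as $n\to\infty$. $\log$ is the natural logarithm. A $q$-bipartite hole in a graph is a pair of disjoint vertex sets $A_1,A_2$ with $|A_1|=|A_2|=q$ such that there is no edge with one end in $A_1$ and the other in $A_2$. Zero forcing: starting from a set of black vertices (others white), repeatedly a black vertex with exactly one white neighbour forces that neighbour to become black; a zero forcing set is one from which all vertices eventually become black, and $Z(G)$ is the minimum size of a zero forcing set. *)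

theory Defs
  imports Complex_Main
begin

definition regular_graphs :: "nat \<Rightarrow> nat \<Rightarrow> nat set set set" where
  "regular_graphs n d =
     {G. G \<subseteq> {e. e \<subseteq> {0..<n} \<and> card e = 2} \<and>
         (\<forall>v<n. card {e\<in>G. v \<in> e} = d)}"

definition prob_reg :: "nat \<Rightarrow> nat \<Rightarrow> (nat \<Rightarrow> nat set set \<Rightarrow> bool) \<Rightarrow> real" where
  "prob_reg n d P =
     real (card {G \<in> regular_graphs n d. P n G}) / real (card (regular_graphs n d))"

definition aas :: "nat \<Rightarrow> (nat \<Rightarrow> nat set set \<Rightarrow> bool) \<Rightarrow> bool" where
  "aas d P \<longleftrightarrow> (\<forall>\<delta>>0. \<exists>N. \<forall>n\<ge>N. even (n * d) \<longrightarrow> prob_reg n d P \<ge> 1 - \<delta>)"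

definition bip_hole :: "nat \<Rightarrow> nat set set \<Rightarrow> nat \<Rightarrow> nat set \<Rightarrow> nat set \<Rightarrow> bool" where
  "bip_hole n G q A1 A2 \<longleftrightarrow>
     A1 \<subseteq> {0..<n} \<and> A2 \<subseteq> {0..<n} \<and> A1 \<inter> A2 = {} \<and>
     card A1 = q \<and> card A2 = q \<and> (\<forall>a\<in>A1. \<forall>b\<in>A2. {a, b} \<notin> G)"

definition has_bip_hole :: "nat \<Rightarrow> nat set set \<Rightarrow> nat \<Rightarrow> bool" where
  "has_bip_hole n G q \<longleftrightarrow> (\<exists>A1 A2. bip_hole n G q A1 A2)"

inductive zf_reach :: "nat set set \<Rightarrow> nat set \<Rightarrow> nat set \<Rightarrow> bool" for G B where
  start: "zf_reach G B B"
| force: "\<lbrakk>zf_reach G B C; v \<in> C; w \<notin> C; {v, w} \<in> G;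
           \<forall>u. {v, u} \<in> G \<and> u \<noteq> w \<longrightarrow> u \<in> C\<rbrakk> \<Longrightarrow> zf_reach G B (insert w C)"

definition zero_forcing_set :: "nat \<Rightarrow> nat set set \<Rightarrow> nat set \<Rightarrow> bool" where
  "zero_forcing_set n G B \<longleftrightarrow> B \<subseteq> {0..<n} \<and> zf_reach G B {0..<n}"

definition zero_forcing_number :: "nat \<Rightarrow> nat set set \<Rightarrow> nat" where
  "zero_forcing_number n G = (LEAST k. \<exists>B. zero_forcing_set n G B \<and> card B = k)"

end

theory Submission
  imports Defs
begin

text \<open>
  Fix disjoint \<open>q\<close>-sets \<open>A\<close>, \<open>B\<close> and let \<open>w k\<close> count the \<open>d\<close>-regular graphs with exactly \<open>k\<close> edges between
  them. Replacing edges \<open>{a, x}\<close>, \<open>{b, y}\<close> with \<open>a \<in> A\<close>, \<open>b \<in> B\<close> by \<open>{a, b}\<close>, \<open>{x, y}\<close> creates one or two new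
  edges between \<open>A\<close> and \<open>B\<close>, and double counting shows that \<open>w\<close> grows at least like the Poisson weights
  \<open>L ^ k / k!\<close> with \<open>L\<close> close to \<open>q\<^sup>2 d / n\<close>, as long as \<open>k \<le> L\<close>. Taking \<open>k\<close> near \<open>L\<close>, the proportion of graphs
  without an edge between \<open>A\<close> and \<open>B\<close> is about \<open>exp (- q\<^sup>2 d / n)\<close>, which beats the at most
  \<open>(e n / q) ^ (2 q)\<close> choices of \<open>(A, B)\<close> once \<open>q \<ge> (1 + \<epsilon>) 2 n ln d / d\<close>. Working with switchings on simple
  graphs avoids the configuration model, so only non-emptiness of the space of \<open>d\<close>-regular
  graphs is needed; circulant graphs provide it.
\<close>

section \<open>Switchings\<close>

lemma finite_regular_graphs: "finite (regular_graphs n d)"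
proof -
  have "finite (Pow {e. e \<subseteq> {0..<n} \<and> card e = 2})"
    by (simp add: finite_subset[of _ "Pow {0..<n}"])
  then show ?thesis
    by (rule finite_subset[rotated]) (auto simp: regular_graphs_def)
qed

definition nbrs :: "nat set set \<Rightarrow> nat \<Rightarrow> nat set" where
  "nbrs G v = {u. {v, u} \<in> G}"

lemma nbrs_sym: "u \<in> nbrs G v \<longleftrightarrow> v \<in> nbrs G u"
  by (simp add: nbrs_def insert_commute)

lemma regular_graphs_edgeD:
  assumes "G \<in> regular_graphs n d" "{u, v} \<in> G"
  shows "u < n" "v < n" "u \<noteq> v"
proof -
  have "{u, v} \<subseteq> {0..<n}" "card {u, v} = 2"
    using assms unfolding regular_graphs_def by blast+
  then show "u < n" "v < n" "u \<noteq> v" by auto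
qed

lemma finite_regular_graph:
  assumes "G \<in> regular_graphs n d" shows "finite G"
proof (rule finite_subset)
  show "G \<subseteq> Pow {0..<n}" using assms unfolding regular_graphs_def by blast
qed simp

text \<open>The bijection sends a neighbour \<open>u\<close> to the edge \<open>{v, u}\<close>.
  Regularity is not assumed, since the lemma also serves to read off the degrees of circulant
  graphs.\<close>

lemma card_nbrs_eq:
  assumes "G \<subseteq> {e. e \<subseteq> {0..<n} \<and> card e = 2}"
  shows "card (nbrs G v) = card {e \<in> G. v \<in> e}"
proof -
  have "bij_betw (\<lambda>u. {v, u}) (nbrs G v) {e \<in> G. v \<in> e}"
  proof (rule bij_betwI')
    fix x y show "({v, x} = {v, y}) = (x = y)" by (auto simp: doubleton_eq_iff)
  next
    fix x assume "x \<in> nbrs G v" then show "{v, x} \<in> {e \<in> G. v \<in> e}" by (simp add: nbrs_def)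
  next
    fix e assume e: "e \<in> {e \<in> G. v \<in> e}"
    then have "card e = 2" using assms by blast
    then obtain x y where "e = {x, y}" by (auto simp: card_2_iff)
    with e have "\<exists>u. e = {v, u}" by auto
    with e show "\<exists>x\<in>nbrs G v. e = {v, x}" by (auto simp: nbrs_def)
  qed
  then show ?thesis by (rule bij_betw_same_card)
qed

lemma card_nbrs:
  assumes "G \<in> regular_graphs n d" "v < n"
  shows "card (nbrs G v) = d"
  using assms card_nbrs_eq[of G n v] unfolding regular_graphs_def by blast

lemma nbrs_less:
  assumes "G \<in> regular_graphs n d" "u \<in> nbrs G v"
  shows "u < n" "v < n" "u \<noteq> v"
  using regular_graphs_edgeD[OF assms(1)] assms(2) unfolding nbrs_def by blast+

lemma finite_nbrs:
  assumes "G \<in> regular_graphs n d" shows "finite (nbrs G v)"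
  by (rule finite_subset[of _ "{0..<n}"]) (auto dest: nbrs_less[OF assms])

lemma card_nbrs_le:
  assumes "G \<in> regular_graphs n d" shows "card (nbrs G v) \<le> d"
proof (cases "v < n")
  case False
  then have "nbrs G v = {}" using nbrs_less[OF assms] by blast
  then show ?thesis by simp
qed (simp add: card_nbrs[OF assms])

section \<open>The switching operation\<close>

definition switch :: "nat set set \<Rightarrow> nat \<Rightarrow> nat \<Rightarrow> nat \<Rightarrow> nat \<Rightarrow> nat set set" where
  "switch G a x b y = (G - {{a, x}, {b, y}}) \<union> {{a, b}, {x, y}}"

definition switchable :: "nat set set \<Rightarrow> nat \<Rightarrow> nat \<Rightarrow> nat \<Rightarrow> nat \<Rightarrow> bool" where
  "switchable G a x b y \<longleftrightarrow> distinct [a, x, b, y] \<and> {a, x} \<in> G \<and> {b, y} \<in> G \<and> {a, b} \<notin> G \<and> {x, y} \<notin> G"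

text \<open>One identity for two purposes: with the indicator of containing \<open>v\<close> it
  gives preservation of degrees, with the indicator of joining \<open>A\<close> to \<open>B\<close>
  the change in the number of such edges.\<close>

lemma sum_switch:
  fixes f :: "nat set \<Rightarrow> nat"
  assumes "finite G" and s: "switchable G a x b y"
  shows "sum f (switch G a x b y) + f {a, x} + f {b, y} = sum f G + f {a, b} + f {x, y}"
proof -
  let ?K = "G - {{a, x}, {b, y}}"
  have ne: "{a, x} \<noteq> {b, y}" "{a, b} \<noteq> {x, y}"
    using s by (auto simp: switchable_def doubleton_eq_iff)
  have "G = ?K \<union> {{a, x}, {b, y}}" using s by (auto simp: switchable_def)
  then have 1: "sum f G = sum f ?K + (f {a, x} + f {b, y})"
    using sum.union_disjoint[of ?K "{{a, x}, {b, y}}" f] \<open>finite G\<close> ne by auto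
  have "?K \<inter> {{a, b}, {x, y}} = {}" using s by (auto simp: switchable_def)
  then have 2: "sum f (switch G a x b y) = sum f ?K + (f {a, b} + f {x, y})"
    using sum.union_disjoint[of ?K "{{a, b}, {x, y}}" f] \<open>finite G\<close> ne
    by (auto simp: switch_def)
  from 1 2 show ?thesis by simp
qed

text \<open>Recovers \<open>G\<close> from the result and the four vertices, which makes the map in
  the double counting injective.\<close>

lemma unswitch:
  assumes "switchable G a x b y"
  shows "(switch G a x b y - {{a, b}, {x, y}}) \<union> {{a, x}, {b, y}} = G"
  using assms unfolding switchable_def switch_def by auto

lemma switch_regular:
  assumes G: "G \<in> regular_graphs n d" and s: "switchable G a x b y"
  shows "switch G a x b y \<in> regular_graphs n d"
proof -
  have fin: "finite G" by (rule finite_regular_graph[OF G])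
  have lt: "a < n" "x < n" "b < n" "y < n"
    using regular_graphs_edgeD[OF G] s by (auto simp: switchable_def)
  have "card {a, b} = 2" "card {x, y} = 2" using s by (auto simp: switchable_def)
  then have sub: "switch G a x b y \<subseteq> {e. e \<subseteq> {0..<n} \<and> card e = 2}"
    using G lt unfolding switch_def regular_graphs_def by auto
  have "card {e \<in> switch G a x b y. v \<in> e} = d" if "v < n" for v
  proof -
    let ?f = "\<lambda>e. of_bool (v \<in> e) :: nat"
    have card_sum: "card {e \<in> H. v \<in> e} = sum ?f H" if "finite H" for H :: "nat set set"
      using that by (simp add: sum_of_bool_eq Int_def)
    \<comment> \<open>By distinctness, each of the four vertices lies on exactly one removed and one
      added edge.\<close>
    have "?f {a, x} + ?f {b, y} = ?f {a, b} + ?f {x, y}"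
      using s by (auto simp: switchable_def)
    with sum_switch[OF fin s, of ?f] have "sum ?f (switch G a x b y) = sum ?f G" by linarith
    moreover have "finite (switch G a x b y)" using fin by (simp add: switch_def)
    ultimately have "card {e \<in> switch G a x b y. v \<in> e} = card {e \<in> G. v \<in> e}"
      using card_sum fin by simp
    then show ?thesis using G that by (simp add: regular_graphs_def)
  qed
  with sub show ?thesis by (simp add: regular_graphs_def)
qed

section \<open>Edges between two vertex sets\<close>

definition cross_pairs :: "nat set \<Rightarrow> nat set \<Rightarrow> nat set set \<Rightarrow> (nat \<times> nat) set" where
  "cross_pairs A B G = {(a, b). a \<in> A \<and> b \<in> B \<and> {a, b} \<in> G}"

text \<open>For disjoint \<open>A\<close> and \<open>B\<close> an edge determines which of its ends
  lies in \<open>A\<close>, so ordered pairs count edges. A sum over edges is the form to which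
  \<open>sum_switch\<close> applies.\<close>

lemma card_cross_pairs_eq_sum:
  assumes "finite G" "A \<inter> B = {}"
  shows "card (cross_pairs A B G) = (\<Sum>e\<in>G. of_bool (\<exists>a\<in>A. \<exists>b\<in>B. e = {a, b}))"
proof -
  have "bij_betw (\<lambda>(a, b). {a, b}) (cross_pairs A B G) {e \<in> G. \<exists>a\<in>A. \<exists>b\<in>B. e = {a, b}}"
    using assms(2) by (auto simp: bij_betw_def inj_on_def cross_pairs_def doubleton_eq_iff)
  then have "card (cross_pairs A B G) = card {e \<in> G. \<exists>a\<in>A. \<exists>b\<in>B. e = {a, b}}"
    by (rule bij_betw_same_card)
  then show ?thesis using assms(1) by (simp add: sum_of_bool_eq Int_def)
qed

lemma card_cross_pairs_commute: "card (cross_pairs B A G) = card (cross_pairs A B G)"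
proof -
  have "cross_pairs B A G = prod.swap ` cross_pairs A B G"
    by (auto simp: cross_pairs_def insert_commute image_iff)
  then show ?thesis by (simp add: card_image)
qed

text \<open>As \<open>x\<close> is outside \<open>B\<close> and \<open>y\<close> outside
  \<open>A\<close>, neither removed edge joins \<open>A\<close> to \<open>B\<close>;
  \<open>{a, b}\<close> does, and \<open>{x, y}\<close> can do so only with \<open>x\<close> in
  \<open>A\<close> and \<open>y\<close> in \<open>B\<close>.\<close>

lemma card_cross_pairs_switch:
  assumes "G \<in> regular_graphs n d" "A \<inter> B = {}" "switchable G a x b y"
    and "a \<in> A" "x \<notin> B" "b \<in> B" "y \<notin> A"
  shows "card (cross_pairs A B (switch G a x b y)) =
         card (cross_pairs A B G) + 1 + of_bool (x \<in> A \<and> y \<in> B)"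
proof -
  let ?f = "\<lambda>e. of_bool (\<exists>a\<in>A. \<exists>b\<in>B. e = {a, b}) :: nat"
  have fin: "finite G" by (rule finite_regular_graph[OF assms(1)])
  have "?f {a, x} = 0" "?f {b, y} = 0" "?f {a, b} = 1" "?f {x, y} = of_bool (x \<in> A \<and> y \<in> B)"
    using assms by (auto simp: doubleton_eq_iff)
  with sum_switch[OF fin assms(3), of ?f]
  have "sum ?f (switch G a x b y) = sum ?f G + 1 + of_bool (x \<in> A \<and> y \<in> B)" by linarith
  moreover have "finite (switch G a x b y)" using fin by (simp add: switch_def)
  ultimately show ?thesis using card_cross_pairs_eq_sum fin assms(2) by simp
qed

text \<open>The arcs leaving \<open>A\<close> split by whether they end in \<open>B\<close>. With
  all vertices for \<open>A\<close> and \<open>{}\<close> for \<open>B\<close> this counts the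
  \<open>n * d\<close> arcs of the graph.\<close>

lemma card_outgoing:
  assumes G: "G \<in> regular_graphs n d" and A: "A \<subseteq> {0..<n}" and "card A = q"
  shows "card (SIGMA a:A. nbrs G a - B) + card (cross_pairs A B G) = q * d"
proof -
  have finA: "finite A" using A finite_subset by auto
  have "(SIGMA a:A. nbrs G a) = (SIGMA a:A. nbrs G a - B) \<union> cross_pairs A B G"
    "(SIGMA a:A. nbrs G a - B) \<inter> cross_pairs A B G = {}"
    by (auto simp: cross_pairs_def nbrs_def)
  moreover have "finite (SIGMA a:A. nbrs G a)" using finA finite_nbrs[OF G] by auto
  ultimately have "card (SIGMA a:A. nbrs G a) = card (SIGMA a:A. nbrs G a - B) + card (cross_pairs A B G)"
    by (metis card_Un_disjoint finite_Un)
  moreover have "card (SIGMA a:A. nbrs G a) = q * d"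
  proof -
    have "card (SIGMA a:A. nbrs G a) = (\<Sum>a\<in>A. card (nbrs G a))"
      using finA finite_nbrs[OF G] by (simp add: card_SigmaI)
    also have "\<dots> = (\<Sum>a\<in>A. d)"
      using A by (intro sum.cong refl card_nbrs[OF G]) auto
    finally show ?thesis using assms(3) by simp
  qed
  ultimately show ?thesis by simp
qed

section \<open>Counting switchings\<close>

definition switchings :: "nat set \<Rightarrow> nat set \<Rightarrow> nat set set \<Rightarrow> ((nat \<times> nat) \<times> (nat \<times> nat)) set" where
  "switchings A B G = {((a, x), (b, y)). a \<in> A \<and> x \<notin> B \<and> b \<in> B \<and> y \<notin> A \<and> switchable G a x b y}"

lemma finite_switchings:
  assumes "G \<in> regular_graphs n d" "finite A" "finite B"
  shows "finite (switchings A B G)"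
proof (rule finite_subset)
  show "switchings A B G \<subseteq> (A \<times> {0..<n}) \<times> (B \<times> {0..<n})"
    using regular_graphs_edgeD[OF assms(1)] unfolding switchings_def switchable_def by auto
qed (use assms in auto)

text \<open>
  For a fixed arc \<open>(a, x)\<close>, an arc \<open>(b, y)\<close> is unusable only if \<open>y = x\<close>, \<open>b \<sim> a\<close> or
  \<open>y \<sim> x\<close>, which excludes at most \<open>d + 2 d\<^sup>2 \<le> 3 d\<^sup>2\<close> arcs.
\<close>

lemma card_switchings_ge:
  assumes G: "G \<in> regular_graphs n d" and A: "A \<subseteq> {0..<n}" "card A = q"
    and B: "B \<subseteq> {0..<n}" "card B = q" and disj: "A \<inter> B = {}"
    and k: "card (cross_pairs A B G) = k"
  shows "(real (q * d) - real k)\<^sup>2 - 3 * real q * real d ^ 3 \<le> real (card (switchings A B G))"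
proof -
  define E1 where "E1 = (SIGMA a:A. nbrs G a - B)"
  define E2 where "E2 = (SIGMA b:B. nbrs G b - A)"
  define bad where "bad = (\<lambda>(a, x). (\<lambda>b. (b, x)) ` nbrs G x
      \<union> (SIGMA b:nbrs G a. nbrs G b) \<union> prod.swap ` (SIGMA y:nbrs G x. nbrs G y))"
  have finA: "finite A" and finB: "finite B" using A B finite_subset by auto
  note finN = finite_nbrs[OF G]
  have fin: "finite E1" "finite E2" unfolding E1_def E2_def using finA finB finN by auto
  have c1: "card E1 + k = q * d"
    using card_outgoing[OF G A, of B] k unfolding E1_def by auto
  have c2: "card E2 + k = q * d"
    using card_outgoing[OF G B, of A] k card_cross_pairs_commute[of B A G] unfolding E2_def by auto
  have sig: "card (SIGMA u:nbrs G v. nbrs G u) \<le> d * d" for v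
  proof -
    have "card (SIGMA u:nbrs G v. nbrs G u) = (\<Sum>u\<in>nbrs G v. card (nbrs G u))"
      using finN by (simp add: card_SigmaI)
    also have "\<dots> \<le> card (nbrs G v) * d"
      using sum_bounded_above[of "nbrs G v" "\<lambda>u. card (nbrs G u)" d] card_nbrs_le[OF G] by simp
    also have "\<dots> \<le> d * d" using card_nbrs_le[OF G] by simp
    finally show ?thesis .
  qed
  have finS: "finite (SIGMA u:nbrs G v. nbrs G u)" for v using finN by auto
  have cbad: "card (bad p) \<le> 3 * d ^ 2" for p
  proof -
    obtain a x where p: "p = (a, x)" by force
    have "card (bad p) \<le> card ((\<lambda>b. (b, x)) ` nbrs G x) + card (SIGMA b:nbrs G a. nbrs G b)
        + card (prod.swap ` (SIGMA y:nbrs G x. nbrs G y))"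
      unfolding p bad_def
      by (simp del: card_SigmaI) (meson add_le_mono card_Un_le le_refl order_trans)
    also have "\<dots> \<le> d + d * d + d * d"
      by (intro add_mono sig order_trans[OF card_image_le] card_nbrs_le[OF G] finN finS)
    also have "\<dots> \<le> 3 * d ^ 2" by (cases d) (auto simp: power2_eq_square)
    finally show ?thesis .
  qed
  have finbad: "finite (bad p)" for p
    unfolding bad_def using finN finS by (cases p) auto
  have sub: "(SIGMA p:E1. E2 - bad p) \<subseteq> switchings A B G"
  proof (rule subsetI, clarify)
    fix a x b y
    assume ax: "(a, x) \<in> E1" and be: "(b, y) \<in> E2" and nb: "(b, y) \<notin> bad (a, x)"
    have e: "a \<in> A" "x \<notin> B" "b \<in> B" "y \<notin> A" "x \<in> nbrs G a" "y \<in> nbrs G b"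
      using ax be by (auto simp: E1_def E2_def)
    have xy: "x \<noteq> y" using nb e by (auto simp: bad_def nbrs_sym)
    have ab: "b \<notin> nbrs G a" using nb e by (auto simp: bad_def)
    have "y \<notin> nbrs G x"
    proof
      assume "y \<in> nbrs G x"
      then have "(y, b) \<in> (SIGMA y:nbrs G x. nbrs G y)" using e nbrs_sym by auto
      then have "(b, y) \<in> prod.swap ` (SIGMA y:nbrs G x. nbrs G y)" by (force simp: image_iff)
      then show False using nb by (simp add: bad_def)
    qed
    \<comment> \<open>Of the six inequalities in \<open>distinct\<close>, these two are the absence
      of loops and \<open>x \<noteq> y\<close> is shown above; the other three follow from
      \<open>disj\<close>, \<open>x \<notin> B\<close> and \<open>y \<notin> A\<close>.\<close>
    moreover have "a \<noteq> x" "b \<noteq> y" using nbrs_less(3)[OF G] e by blast+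
    ultimately show "((a, x), (b, y)) \<in> switchings A B G"
      using e xy ab disj unfolding switchings_def switchable_def nbrs_def by auto
  qed
  have "real (card E1) * (real (card E2) - 3 * real d ^ 2) = (\<Sum>p\<in>E1. real (card E2) - 3 * real d ^ 2)"
    by simp
  also have "\<dots> \<le> (\<Sum>p\<in>E1. real (card (E2 - bad p)))"
  proof (rule sum_mono)
    fix p
    have "card E2 \<le> card (E2 - bad p) + card (bad p)"
      by (metis add.commute card_Un_le card_mono finbad fin(2) Un_Diff_cancel finite_UnI le_trans sup_ge2)
    also have "\<dots> \<le> card (E2 - bad p) + 3 * d ^ 2" using cbad by simp
    finally have "real (card E2) \<le> real (card (E2 - bad p) + 3 * d ^ 2)" by (rule of_nat_mono)
    then show "real (card E2) - 3 * real d ^ 2 \<le> real (card (E2 - bad p))" by simp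
  qed
  also have "\<dots> = real (card (SIGMA p:E1. E2 - bad p))"
    using fin by (simp add: card_SigmaI)
  also have "\<dots> \<le> real (card (switchings A B G))"
    using card_mono[OF finite_switchings[OF G finA finB] sub] by simp
  finally have "real (card E1) * (real (card E2) - 3 * real d ^ 2) \<le> real (card (switchings A B G))" .
  moreover have "real (card E1) = real (q * d) - real k" "real (card E2) = real (q * d) - real k"
    using c1 c2 by linarith+
  \<comment> \<open>In the error term the factor \<open>q * d - k\<close> is replaced by
    \<open>q * d\<close>.\<close>
  moreover have "(real (q * d) - real k)\<^sup>2 - 3 * real q * real d ^ 3
      \<le> (real (q * d) - real k) * (real (q * d) - real k - 3 * real d ^ 2)"
    by (simp add: power2_eq_square power3_eq_cube algebra_simps)
  ultimately show ?thesis by simp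
qed

definition graphs_with_cross :: "nat \<Rightarrow> nat \<Rightarrow> nat set \<Rightarrow> nat set \<Rightarrow> nat \<Rightarrow> nat set set set" where
  "graphs_with_cross n d A B k = {G \<in> regular_graphs n d. card (cross_pairs A B G) = k}"

text \<open>
  Double counting of switchings. The second term on the right accounts for switchings whose
  other new edge \<open>{x, y}\<close> also joins \<open>A\<close> to \<open>B\<close>; they cannot be discarded, because \<open>A\<close> and \<open>B\<close> might
  carry almost all their edges inside.
\<close>

lemma switching_inequality:
  fixes d k :: nat
  assumes A: "A \<subseteq> {0..<n}" "card A = q"
    and B: "B \<subseteq> {0..<n}" "card B = q" and disj: "A \<inter> B = {}"
  defines "w \<equiv> \<lambda>k. real (card (graphs_with_cross n d A B k))"
  shows "w k * ((real (q * d) - real k)\<^sup>2 - 3 * real q * real d ^ 3)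
      \<le> w (k + 1) * (real (k + 1) * real (n * d)) + w (k + 2) * (real (k + 2))\<^sup>2"
proof -
  let ?S = "graphs_with_cross n d A B"
  \<comment> \<open>After a switching, \<open>(a, b)\<close> is an edge from \<open>A\<close> to
    \<open>B\<close>, and \<open>(x, y)\<close> is either some arc of the new graph
    (\<open>P\<close>) or, when it too runs from \<open>A\<close> to \<open>B\<close>, a second such
    pair (\<open>Q\<close>).\<close>
  define P where "P = (\<lambda>H. cross_pairs A B H \<times> (SIGMA x:{0..<n}. nbrs H x))"
  define Q where "Q = (\<lambda>H. cross_pairs A B H \<times> cross_pairs A B H)"
  define \<phi> :: "nat set set \<times> ((nat \<times> nat) \<times> (nat \<times> nat)) \<Rightarrow> nat set set \<times> ((nat \<times> nat) \<times> (nat \<times> nat))"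
    where "\<phi> = (\<lambda>(G, ((a, x), (b, y))). (switch G a x b y, ((a, b), (x, y))))"
  have finA: "finite A" and finB: "finite B" using A B finite_subset by auto
  have finS: "finite (?S j)" for j
    unfolding graphs_with_cross_def using finite_regular_graphs by simp
  have SR: "G \<in> regular_graphs n d" if "G \<in> ?S j" for G j
    using that by (simp add: graphs_with_cross_def)
  have finC: "finite (cross_pairs A B G)" for G
    by (rule finite_subset[of _ "A \<times> B"]) (auto simp: cross_pairs_def finA finB)
  have inj: "inj_on \<phi> (SIGMA G:?S k. switchings A B G)"
  proof (rule inj_onI, clarify)
    fix G a x b y G' a' x' b' y'
    assume s: "((a, x), (b, y)) \<in> switchings A B G" "((a', x'), (b', y')) \<in> switchings A B G'"
      and eq: "\<phi> (G, ((a, x), (b, y))) = \<phi> (G', ((a', x'), (b', y')))"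
    have sw: "switchable G a x b y" "switchable G' a' x' b' y'"
      using s by (auto simp: switchings_def)
    have eqs: "a = a'" "x = x'" "b = b'" "y = y'" "switch G a x b y = switch G' a x b y"
      using eq by (auto simp: \<phi>_def)
    have "G = G'" using unswitch[OF sw(1), unfolded eqs(5)] unswitch[OF sw(2), folded eqs(1-4)] by blast
    then show "G = G' \<and> ((a, x), (b, y)) = ((a', x'), (b', y'))" using eqs by simp
  qed
  have image: "\<phi> ` (SIGMA G:?S k. switchings A B G) \<subseteq> (SIGMA H:?S (k + 1). P H) \<union> (SIGMA H:?S (k + 2). Q H)"
  proof (rule image_subsetI, clarify)
    fix G a x b y
    assume GS: "G \<in> ?S k" and s: "((a, x), (b, y)) \<in> switchings A B G"
      and nQ: "\<phi> (G, ((a, x), (b, y))) \<notin> (SIGMA H:?S (k + 2). Q H)"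
    let ?H = "switch G a x b y"
    have sw: "switchable G a x b y" and m: "a \<in> A" "x \<notin> B" "b \<in> B" "y \<notin> A"
      using s by (auto simp: switchings_def)
    have H: "?H \<in> regular_graphs n d" by (rule switch_regular[OF SR[OF GS] sw])
    have c: "card (cross_pairs A B ?H) = k + 1 + of_bool (x \<in> A \<and> y \<in> B)"
      using card_cross_pairs_switch[OF SR[OF GS] disj sw m] GS by (simp add: graphs_with_cross_def)
    have e: "{a, b} \<in> ?H" "{x, y} \<in> ?H" by (auto simp: switch_def)
    have "\<not> (x \<in> A \<and> y \<in> B)"
      using nQ H c e m by (auto simp: \<phi>_def Q_def graphs_with_cross_def cross_pairs_def)
    then show "\<phi> (G, ((a, x), (b, y))) \<in> (SIGMA H:?S (k + 1). P H)"
      using H c e m regular_graphs_edgeD[OF H e(2)]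
      by (auto simp: \<phi>_def P_def graphs_with_cross_def cross_pairs_def nbrs_def)
  qed
  have cP: "card (P H) = (k + 1) * (n * d)" if "H \<in> ?S (k + 1)" for H
  proof -
    have "card (SIGMA x:{0..<n}. nbrs H x) = n * d"
      using card_outgoing[OF SR[OF that], of "{0..<n}" n "{}"] by (simp add: cross_pairs_def)
    then show ?thesis
      using that by (simp add: P_def card_cartesian_product graphs_with_cross_def del: card_SigmaI)
  qed
  have cQ: "card (Q H) = (k + 2)\<^sup>2" if "H \<in> ?S (k + 2)" for H
    using that by (simp add: Q_def card_cartesian_product graphs_with_cross_def power2_eq_square)
  have finP: "finite (P H)" if "H \<in> ?S j" for H j
    unfolding P_def using finC finite_nbrs[OF SR[OF that]] by auto
  have finQ: "finite (Q H)" for H unfolding Q_def using finC by auto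
  have "w k * ((real (q * d) - real k)\<^sup>2 - 3 * real q * real d ^ 3)
      = (\<Sum>G\<in>?S k. (real (q * d) - real k)\<^sup>2 - 3 * real q * real d ^ 3)"
    by (simp add: w_def)
  also have "\<dots> \<le> (\<Sum>G\<in>?S k. real (card (switchings A B G)))"
    using card_switchings_ge[OF SR A B disj]
    by (intro sum_mono) (auto simp: graphs_with_cross_def)
  also have "\<dots> = real (card (SIGMA G:?S k. switchings A B G))"
    using finS finite_switchings[OF SR finA finB] by (simp add: card_SigmaI)
  also have "\<dots> = real (card (\<phi> ` (SIGMA G:?S k. switchings A B G)))"
    using card_image[OF inj] by simp
  also have "\<dots> \<le> real (card ((SIGMA H:?S (k + 1). P H) \<union> (SIGMA H:?S (k + 2). Q H)))"
    using finS finP finQ by (intro of_nat_mono card_mono image) auto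
  also have "\<dots> \<le> real (card (SIGMA H:?S (k + 1). P H) + card (SIGMA H:?S (k + 2). Q H))"
    by (intro of_nat_mono card_Un_le)
  also have "\<dots> = w (k + 1) * (real (k + 1) * real (n * d)) + w (k + 2) * (real (k + 2))\<^sup>2"
  proof -
    have "card (SIGMA H:?S (k + 1). P H) = card (?S (k + 1)) * ((k + 1) * (n * d))"
      using finS finP cP by (subst card_SigmaI) auto
    moreover have "card (SIGMA H:?S (k + 2). Q H) = card (?S (k + 2)) * (k + 2)\<^sup>2"
      using finS finQ cQ by (subst card_SigmaI) auto
    ultimately show ?thesis unfolding w_def by (simp only: of_nat_add of_nat_mult of_nat_power)
  qed
  finally show ?thesis .
qed

section \<open>Circulant graphs\<close>

text \<open>Labels are joined when their difference modulo \<open>n\<close> lies in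
  \<open>D\<close>; closure under \<open>s \<mapsto> n - s\<close> makes the relation
  symmetric.\<close>

lemma circulant_regular:
  assumes D: "D \<subseteq> {1..<n}" and sym: "\<And>s. s \<in> D \<Longrightarrow> n - s \<in> D"
  shows "{{i, j} | i j. i < j \<and> j < n \<and> j - i \<in> D} \<in> regular_graphs n (card D)"
proof -
  define G where "G = {{i, j} | i j. i < j \<and> j < n \<and> j - i \<in> D}"
  have edge: "{i, j} \<in> G \<longleftrightarrow> i < n \<and> j < n \<and> (i < j \<and> j - i \<in> D \<or> j < i \<and> i - j \<in> D)" for i j
    by (auto simp: G_def doubleton_eq_iff)
  have sub: "G \<subseteq> {e. e \<subseteq> {0..<n} \<and> card e = 2}" by (auto simp: G_def)
  have "card (nbrs G v) = card D" if v: "v < n" for v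
  proof -
    \<comment> \<open>This is \<open>u \<mapsto> (u - v) mod n\<close>, with inverse
      \<open>s \<mapsto> (v + s) mod n\<close>, written by cases.\<close>
    have "bij_betw (\<lambda>u. if v < u then u - v else n - (v - u)) (nbrs G v) D"
    proof (rule bij_betw_byWitness[where f' = "\<lambda>s. if v + s < n then v + s else v + s - n"])
      show "\<forall>u\<in>nbrs G v. (\<lambda>s. if v + s < n then v + s else v + s - n)
          (if v < u then u - v else n - (v - u)) = u"
        using v by (auto simp: nbrs_def edge)
      show "\<forall>s\<in>D. (\<lambda>u. if v < u then u - v else n - (v - u))
          (if v + s < n then v + s else v + s - n) = s"
        using v D by force
      show "(\<lambda>u. if v < u then u - v else n - (v - u)) ` nbrs G v \<subseteq> D"
        using v sym by (force simp: nbrs_def edge simp del: diff_diff_right)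
      show "(\<lambda>s. if v + s < n then v + s else v + s - n) ` D \<subseteq> nbrs G v"
      proof (rule image_subsetI)
        fix s assume s: "s \<in> D"
        then have s': "0 < s" "s < n" using D by auto
        show "(if v + s < n then v + s else v + s - n) \<in> nbrs G v"
        proof (cases "v + s < n")
          case True
          then show ?thesis using s s' v by (simp add: nbrs_def edge)
        next
          case False
          then have "v - (v + s - n) = n - s" using s' by linarith
          then show ?thesis using False s s' v sym[OF s] by (auto simp: nbrs_def edge)
        qed
      qed
    qed
    then show ?thesis by (rule bij_betw_same_card)
  qed
  then have "G \<in> regular_graphs n (card D)"
    using sub card_nbrs_eq[OF sub] by (simp add: regular_graphs_def)
  then show ?thesis by (simp add: G_def)
qed

text \<open>Ensures that \<open>prob_reg\<close> is a genuine quotient and not 0 by the convention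
  for division by zero.\<close>

lemma regular_graphs_nonempty:
  assumes "d < n" "even (n * d)"
  shows "regular_graphs n d \<noteq> {}"
proof -
  define h where "h = d div 2"
  \<comment> \<open>The \<open>h\<close> smallest differences and their complements give degree
    \<open>2 * h\<close>. For odd \<open>d\<close> the order \<open>n\<close> is even, and
    \<open>n div 2\<close>, which is its own complement, adds the missing one.\<close>
  define D0 where "D0 = {1..h} \<union> {n - h..<n}"
  define D where "D = (if even d then D0 else insert (n div 2) D0)"
  have h: "2 * h < n" using assms by (auto simp: h_def)
  have D0: "card D0 = 2 * h"
    using h unfolding D0_def by (subst card_Un_disjoint) auto
  have sym0: "n - s \<in> D0" if "s \<in> D0" for s
    using that h unfolding D0_def by simp linarith
  have "D \<subseteq> {1..<n} \<and> (\<forall>s\<in>D. n - s \<in> D) \<and> card D = d"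
  proof (cases "even d")
    case True
    then have "card D = d" using D0 by (simp add: D_def h_def)
    moreover have "D \<subseteq> {1..<n}" using h True by (auto simp: D_def D0_def)
    ultimately show ?thesis using sym0 True by (simp add: D_def)
  next
    case False
    then have n: "even n" using assms by simp
    have d: "d = 2 * h + 1" using False by (simp add: h_def)
    have "2 * (n div 2) = n" using n by simp
    then have m: "n div 2 \<notin> D0" "n - n div 2 = n div 2" "0 < n div 2" "n div 2 < n"
      using d assms by (auto simp: D0_def)
    have "finite D0" by (simp add: D0_def)
    then have "card D = d" using False m D0 d by (simp add: D_def)
    moreover have "D \<subseteq> {1..<n}" using h m False by (auto simp: D_def D0_def)
    ultimately show ?thesis using sym0 m False by (simp add: D_def)
  qed
  then show ?thesis using circulant_regular[of D n] by auto
qed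

section \<open>Zero forcing and holes\<close>

lemma zf_reach_finite: "zf_reach G B C \<Longrightarrow> finite B \<Longrightarrow> finite C"
  by (induction rule: zf_reach.induct) auto

text \<open>\<open>U\<close> collects the vertices that have forced. Each force adds one vertex to
  \<open>U\<close> and one to \<open>C\<close>, and a vertex that has forced has no white neighbour
  left.\<close>

lemma zf_reach_forcers:
  assumes "zf_reach G B C" "finite B"
  shows "\<exists>U\<subseteq>C. card U + card B = card C \<and> (\<forall>v\<in>U. \<forall>u. {v, u} \<in> G \<longrightarrow> u \<in> C)"
  using assms
proof (induction rule: zf_reach.induct)
  case start
  then show ?case by (intro exI[of _ "{}"]) simp
next
  case (force C v w)
  then obtain U where U: "U \<subseteq> C" "card U + card B = card C" "\<forall>v\<in>U. \<forall>u. {v, u} \<in> G \<longrightarrow> u \<in> C"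
    by blast
  have finC: "finite C" using zf_reach_finite force by blast
  \<comment> \<open>\<open>v\<close> still has the white neighbour \<open>w\<close>, so it has not
    forced before.\<close>
  have "v \<notin> U" using U(3) force by blast
  then have "card (insert v U) + card B = card (insert w C)"
    using U finC force finite_subset[OF U(1)] by simp
  moreover have "insert v U \<subseteq> insert w C" using U force by blast
  moreover have "\<forall>v'\<in>insert v U. \<forall>u. {v', u} \<in> G \<longrightarrow> u \<in> insert w C" using U force by blast
  ultimately show ?case by blast
qed

text \<open>The black set grows by one vertex at a time, so no size is skipped.\<close>

lemma zf_reach_intermediate:
  assumes "zf_reach G B C" "finite B" "card B \<le> j" "j \<le> card C"
  shows "\<exists>C'\<subseteq>C. zf_reach G B C' \<and> card C' = j"
  using assms
proof (induction rule: zf_reach.induct)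
  case start
  then show ?case using zf_reach.start by auto
next
  case (force C v w)
  have finC: "finite C" using zf_reach_finite force by blast
  show ?case
  proof (cases "j \<le> card C")
    case True
    then show ?thesis using force by blast
  next
    case False
    then have "j = card (insert w C)" using force finC by simp
    moreover have "zf_reach G B (insert w C)"
      using zf_reach.force force by blast
    ultimately show ?thesis by blast
  qed
qed

text \<open>
  The vertices that perform the first \<open>s\<close> forces have all their neighbours black at that moment,
  so they form a hole together with any \<open>s\<close> of the vertices that are still white.
\<close>

lemma zero_forcing_set_imp_bip_hole:
  assumes zf: "zero_forcing_set n G B" and s: "card B + 2 * s \<le> n"
  shows "has_bip_hole n G s"
proof -
  have B: "B \<subseteq> {0..<n}" "zf_reach G B {0..<n}" using zf by (auto simp: zero_forcing_set_def)
  have finB: "finite B" using B finite_subset by auto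
  obtain C where C: "C \<subseteq> {0..<n}" "zf_reach G B C" "card C = card B + s"
    using zf_reach_intermediate[OF B(2) finB, of "card B + s"] s by auto
  obtain U where U: "U \<subseteq> C" "card U + card B = card C" "\<forall>v\<in>U. \<forall>u. {v, u} \<in> G \<longrightarrow> u \<in> C"
    using zf_reach_forcers[OF C(2) finB] by blast
  have "card ({0..<n} - C) = n - card C"
    using C(1) by (simp add: card_Diff_subset finite_subset)
  then have "s \<le> card ({0..<n} - C)" using C s by simp
  then obtain W where W: "W \<subseteq> {0..<n} - C" "card W = s" by (meson obtain_subset_with_card_n)
  have "bip_hole n G s U W" unfolding bip_hole_def using U C W by auto
  then show ?thesis by (auto simp: has_bip_hole_def)
qed

text \<open>The whole vertex set is zero forcing, so the minimum is attained.\<close>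

lemma zero_forcing_set_zero_forcing_number:
  "\<exists>B. zero_forcing_set n G B \<and> card B = zero_forcing_number n G"
  unfolding zero_forcing_number_def
  by (rule LeastI_ex) (auto simp: zero_forcing_set_def intro: zf_reach.start)

text \<open>Reduces the claim for all large \<open>q\<close> to the smallest such \<open>q\<close>,
  so that no sum over sizes is needed.\<close>

lemma has_bip_hole_mono:
  assumes "has_bip_hole n G q" "p \<le> q"
  shows "has_bip_hole n G p"
proof -
  obtain A B where h: "bip_hole n G q A B" using assms by (auto simp: has_bip_hole_def)
  then obtain A' B' where "A' \<subseteq> A" "card A' = p" "B' \<subseteq> B" "card B' = p"
    using assms(2) by (metis bip_hole_def obtain_subset_with_card_n)
  with h have "bip_hole n G p A' B'" unfolding bip_hole_def by blast
  then show ?thesis by (auto simp: has_bip_hole_def)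
qed

section \<open>Probability of a hole\<close>

text \<open>A weak Stirling bound, \<open>m! \<le> e m (m / e)^m\<close>; polynomial factors are
  harmless later. The inductive step is \<open>(1 + 1/m)^(m + 1) \<ge> e\<close>.\<close>

lemma fact_le_power_exp:
  assumes "m \<ge> 1"
  shows "fact m \<le> real m ^ (m + 1) * exp (1 - real m)"
  using assms
proof (induction m rule: dec_induct)
  case base
  then show ?case by simp
next
  case (step m)
  have m: "real m > 0" using step by simp
  have "1 / real (m + 1) \<le> ln (1 + 1 / real m)"
  proof -
    have "ln (real m / real (m + 1)) \<le> real m / real (m + 1) - 1"
      using m by (intro ln_le_minus_one) simp
    moreover have "ln (real m / real (m + 1)) = - ln (1 + 1 / real m)"
      using m by (simp add: ln_div field_simps)
    moreover have "real m / real (m + 1) - 1 = - (1 / real (m + 1))"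
      using m by (simp add: field_simps)
    ultimately show ?thesis by linarith
  qed
  then have "1 \<le> real (m + 1) * ln (1 + 1 / real m)"
    by (simp add: field_simps)
  then have "exp 1 \<le> exp (real (m + 1) * ln (1 + 1 / real m))" by simp
  also have "\<dots> = (1 + 1 / real m) ^ (m + 1)"
    using m by (subst exp_of_nat_mult) (simp add: add_pos_pos)
  also have "\<dots> = real (m + 1) ^ (m + 1) / real m ^ (m + 1)"
    using m by (subst power_divide[symmetric]) (simp add: add_divide_distrib add.commute)
  finally have key: "real m ^ (m + 1) * exp 1 \<le> real (m + 1) ^ (m + 1)"
    using m by (simp add: field_simps)
  have "fact (Suc m) = real (m + 1) * fact m" by simp
  also have "\<dots> \<le> real (m + 1) * (real m ^ (m + 1) * exp (1 - real m))"
    using step.IH by (intro mult_left_mono) auto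
  also have "\<dots> = real (m + 1) * exp (1 - real (Suc m)) * (real m ^ (m + 1) * exp 1)"
  proof -
    have "exp (1 - real m) = exp (1 - real (Suc m)) * exp 1" by (simp add: exp_add[symmetric])
    then show ?thesis by (simp only: mult_ac)
  qed
  also have "\<dots> \<le> real (m + 1) * exp (1 - real (Suc m)) * real (m + 1) ^ (m + 1)"
    by (intro mult_left_mono key) auto
  also have "\<dots> = real (Suc m) ^ (Suc m + 1) * exp (1 - real (Suc m))" by (simp add: algebra_simps)
  finally show ?case .
qed

text \<open>
  After normalising \<open>u k = w k * k! / L ^ k\<close> the recursion becomes
  \<open>u k \<le> u (k + 1) + (2 L / M) * u (k + 2)\<close>, so \<open>max (u k) (u (k + 1))\<close> loses at most a factor
  \<open>1 + 2 L / M\<close> per step.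
\<close>

lemma two_step_recursion_bound:
  fixes w :: "nat \<Rightarrow> real"
  assumes nonneg: "\<And>k. w k \<ge> 0" and W: "\<And>k. w k \<le> W"
    and L: "L > 0" and M: "M > 0" and mL: "real (m + 1) \<le> L"
    and rec: "\<And>k. k < m \<Longrightarrow> w k * (L * M) \<le> w (k + 1) * (real (k + 1) * M) + w (k + 2) * (real (k + 2))\<^sup>2"
  shows "w 0 \<le> (1 + 2 * L / M) ^ m * (fact m / L ^ m) * W"
proof -
  define u where "u k = w k * fact k / L ^ k" for k
  define \<eta> where "\<eta> = 2 * L / M"
  have \<eta>: "\<eta> \<ge> 0" using L M by (simp add: \<eta>_def)
  have u: "u k \<ge> 0" for k using nonneg L by (simp add: u_def)
  have step: "u k \<le> u (k + 1) + \<eta> * u (k + 2)" if "k < m" for k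
  proof -
    \<comment> \<open>\<open>k + 2 \<le> 2 (k + 1)\<close> turns the square into a quotient of
      factorials, at the price of the factor 2 in \<open>\<eta>\<close>.\<close>
    have "w (k + 2) * (real (k + 2))\<^sup>2 \<le> w (k + 2) * (2 * (real (k + 2) * real (k + 1)))"
      by (intro mult_left_mono nonneg) (simp add: power2_eq_square algebra_simps)
    with rec[OF that]
    have "w k * (L * M) \<le> w (k + 1) * (real (k + 1) * M) + w (k + 2) * (2 * (real (k + 2) * real (k + 1)))"
      by linarith
    then have "w k * (L * M) * (fact k / (L ^ (k + 1) * M)) \<le>
      (w (k + 1) * (real (k + 1) * M) + w (k + 2) * (2 * (real (k + 2) * real (k + 1)))) * (fact k / (L ^ (k + 1) * M))"
      using L M by (intro mult_right_mono) auto
    also have "w k * (L * M) * (fact k / (L ^ (k + 1) * M)) = u k"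
      using L M by (simp add: u_def field_simps)
    also have "(w (k + 1) * (real (k + 1) * M) + w (k + 2) * (2 * (real (k + 2) * real (k + 1)))) * (fact k / (L ^ (k + 1) * M))
      = u (k + 1) + \<eta> * u (k + 2)"
      using L M by (simp add: u_def \<eta>_def field_simps)
    finally show ?thesis .
  qed
  have "max (u 0) (u 1) \<le> (1 + \<eta>) ^ j * max (u j) (u (j + 1))" if "j \<le> m" for j
    using that
  proof (induction j)
    case (Suc j)
    let ?x = "max (u (j + 1)) (u (j + 2))"
    have x: "0 \<le> ?x" using u[of "j + 1"] by linarith
    have "\<eta> * u (j + 2) \<le> \<eta> * ?x" using \<eta> by (intro mult_left_mono) auto
    then have "u j \<le> (1 + \<eta>) * ?x" using step[of j] Suc.prems unfolding distrib_right by simp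
    moreover have "u (j + 1) \<le> (1 + \<eta>) * ?x"
      using mult_nonneg_nonneg[OF \<eta> x] unfolding distrib_right by linarith
    ultimately have "max (u j) (u (j + 1)) \<le> (1 + \<eta>) * ?x" by simp
    then have "(1 + \<eta>) ^ j * max (u j) (u (j + 1)) \<le> (1 + \<eta>) ^ j * ((1 + \<eta>) * ?x)"
      using \<eta> by (intro mult_left_mono) auto
    with Suc show ?case by (simp add: mult_ac)
  qed simp
  from this[of m] have "u 0 \<le> (1 + \<eta>) ^ m * max (u m) (u (m + 1))" by simp
  also have "max (u m) (u (m + 1)) \<le> fact m / L ^ m * W"
  proof (rule max.boundedI)
    have W0: "W \<ge> 0" using nonneg W order_trans by blast
    show "u m \<le> fact m / L ^ m * W"
      using mult_right_mono[OF W[of m], of "fact m / L ^ m"] L by (simp add: u_def mult_ac)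
    \<comment> \<open>Here \<open>m + 1 \<le> L\<close> enters: going from \<open>m\<close> to
      \<open>m + 1\<close> multiplies \<open>k! / L ^ k\<close> by
      \<open>(m + 1) / L \<le> 1\<close>.\<close>
    have "u (m + 1) \<le> W * (fact (m + 1) / L ^ (m + 1))"
      using mult_right_mono[OF W[of "m + 1"], of "fact (m + 1) / L ^ (m + 1)"] L by (simp add: u_def)
    also have "fact (m + 1) / L ^ (m + 1) = (real (m + 1) / L) * (fact m / L ^ m)" by simp
    also have "W * \<dots> \<le> W * (1 * (fact m / L ^ m))"
      using mL L W0 by (intro mult_left_mono mult_right_mono) auto
    finally show "u (m + 1) \<le> fact m / L ^ m * W" by (simp add: mult_ac)
  qed
  finally have "u 0 \<le> (1 + \<eta>) ^ m * (fact m / L ^ m * W)" using \<eta> by (simp add: mult_left_mono)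
  then show ?thesis by (simp add: u_def \<eta>_def mult_ac)
qed

text \<open>The familiar bound \<open>(e n / q)^q\<close>: \<open>n choose q\<close> is at most
  \<open>n^q / q!\<close>, and \<open>q^q / q!\<close> is a single term of the series of
  \<open>exp q\<close>.\<close>

lemma binomial_le_exp_ln:
  assumes "0 < q" "q \<le> n"
  shows "real (n choose q) \<le> exp (real q * (1 + ln (real n / real q)))"
proof -
  have "real (n choose q) * fact q \<le> real n ^ q"
    using binomial_fact_pow[of n q] by (metis of_nat_fact of_nat_le_iff of_nat_mult of_nat_power)
  moreover have "real q ^ q \<le> exp (real q) * fact q"
  proof -
    have "(\<lambda>k. real q ^ k /\<^sub>R fact k) sums exp (real q)" by (rule exp_converges)
    then have "(\<Sum>k\<in>{q}. real q ^ k /\<^sub>R fact k) \<le> exp (real q)"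
      by (metis (no_types, lifting) sum_le_suminf sums_iff finite.emptyI finite.insertI
          divide_inverse_commute of_nat_0_le_iff real_scaleR_def zero_le_divide_iff zero_le_power fact_ge_zero)
    then show ?thesis by (simp add: field_simps)
  qed
  ultimately have "real (n choose q) * fact q * real q ^ q \<le> real n ^ q * (exp (real q) * fact q)"
    by (intro mult_mono) auto
  then have "real (n choose q) \<le> exp (real q) * (real n / real q) ^ q"
    using assms by (simp add: field_simps)
  also have "(real n / real q) ^ q = exp (real q * ln (real n / real q))"
    using assms by (simp add: exp_of_nat_mult)
  finally show ?thesis by (simp add: exp_add distrib_left)
qed

text \<open>\<open>L\<close> is chosen so that a graph with \<open>k \<le> q^2 d / n\<close> edges
  between the sets has at least \<open>L * n * d\<close> switchings: \<open>2 q / n\<close> comes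
  from expanding \<open>(1 - q / n)^2\<close>, and \<open>3 d / q\<close> from the unusable arcs.
  The recursion runs up to about \<open>L\<close>, where \<open>m! / L^m\<close> is
  \<open>exp (- L)\<close> up to polynomial factors.\<close>

lemma card_graphs_with_cross_0_le:
  assumes A: "A \<subseteq> {0..<n}" "card A = q" and B: "B \<subseteq> {0..<n}" "card B = q" and disj: "A \<inter> B = {}"
    and pos: "0 < q" "0 < d"
    and L_def: "L = (1 - 2 * real q / real n - 3 * real d / real q) * (real q ^ 2 * real d / real n)"
    and L2: "L \<ge> 2"
  shows "real (card (graphs_with_cross n d A B 0))
    \<le> L * exp (2 * L ^ 2 / (real n * real d) + 3 - L) * real (card (regular_graphs n d))"
proof -
  \<comment> \<open>The largest \<open>m\<close> with \<open>m + 1 \<le> L\<close>, as the recursion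
    requires; \<open>L \<ge> 2\<close> gives \<open>m \<ge> 1\<close>.\<close>
  define m where "m = nat \<lfloor>L\<rfloor> - 1"
  define R where "R = real (card (regular_graphs n d))"
  define w where "w k = real (card (graphs_with_cross n d A B k))" for k
  have qn: "q \<le> n" using card_mono[OF _ A(1)] A(2) by simp
  have n: "0 < n" using qn pos by simp
  have m: "real m + 1 \<le> L" "L \<le> real m + 2" "m \<ge> 1"
    using L2 unfolding m_def by (simp_all add: of_nat_diff) linarith+
  have Lle: "L \<le> real q ^ 2 * real d / real n"
  proof -
    have "1 - 2 * real q / real n - 3 * real d / real q \<le> 1"
      using divide_nonneg_nonneg[of "2 * real q" "real n"] divide_nonneg_nonneg[of "3 * real d" "real q"]
      by linarith
    then show ?thesis
      unfolding L_def using mult_right_mono[of _ 1 "real q ^ 2 * real d / real n"] by simp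
  qed
  have "w 0 \<le> (1 + 2 * L / (real n * real d)) ^ m * (fact m / L ^ m) * R"
  proof (rule two_step_recursion_bound)
    show "w k \<ge> 0" for k by (simp add: w_def)
    show "w k \<le> R" for k
      unfolding w_def R_def
      by (intro of_nat_mono card_mono finite_regular_graphs) (auto simp: graphs_with_cross_def)
    show "L > 0" using L2 by simp
    show "real n * real d > 0" using n pos by simp
    show "real (m + 1) \<le> L" using m by simp
    fix k assume "k < m"
    then have "real k \<le> real q ^ 2 * real d / real n" using m Lle by linarith
    moreover have "real q ^ 2 * real d / real n \<le> real q * real d"
    proof -
      have "real q * (real q * real d) \<le> real n * (real q * real d)"
        using qn by (intro mult_right_mono) auto
      then show ?thesis using n by (simp add: field_simps power2_eq_square)
    qed
    ultimately have "(real q * real d - real q ^ 2 * real d / real n)\<^sup>2 \<le> (real (q * d) - real k)\<^sup>2"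
      by (intro power_mono) auto
    moreover have "L * (real n * real d) + 3 * real q * real d ^ 3
        \<le> (real q * real d - real q ^ 2 * real d / real n)\<^sup>2"
    proof -
      have "L * (real n * real d) + 3 * real q * real d ^ 3 = (real q * real d)\<^sup>2 * (1 - 2 * (real q / real n))"
        unfolding L_def using n pos by (simp add: field_simps power2_eq_square power3_eq_cube)
      also have "\<dots> \<le> (real q * real d)\<^sup>2 * (1 - real q / real n)\<^sup>2"
        by (intro mult_left_mono) (auto simp: power2_diff)
      also have "\<dots> = (real q * real d - real q ^ 2 * real d / real n)\<^sup>2"
        unfolding power_mult_distrib[symmetric] by (simp add: algebra_simps power2_eq_square)
      finally show ?thesis .
    qed
    ultimately have "L * (real n * real d) \<le> (real (q * d) - real k)\<^sup>2 - 3 * real q * real d ^ 3"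
      by linarith
    then have "w k * (L * (real n * real d)) \<le> w k * ((real (q * d) - real k)\<^sup>2 - 3 * real q * real d ^ 3)"
      by (intro mult_left_mono) (auto simp: w_def)
    also have "\<dots> \<le> w (k + 1) * (real (k + 1) * real (n * d)) + w (k + 2) * (real (k + 2))\<^sup>2"
      unfolding w_def by (rule switching_inequality[OF A B disj])
    finally show "w k * (L * (real n * real d))
        \<le> w (k + 1) * (real (k + 1) * (real n * real d)) + w (k + 2) * (real (k + 2))\<^sup>2" by simp
  qed
  also have "\<dots> \<le> exp (2 * L ^ 2 / (real n * real d)) * (L * exp (3 - L)) * R"
  proof (intro mult_right_mono mult_mono)
    let ?\<eta> = "2 * L / (real n * real d)"
    have \<eta>: "?\<eta> \<ge> 0" using L2 by simp
    have "(1 + ?\<eta>) ^ m \<le> exp ?\<eta> ^ m" using \<eta> by (intro power_mono exp_ge_add_one_self) auto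
    also have "\<dots> = exp (real m * ?\<eta>)" by (rule exp_of_nat_mult[symmetric])
    also have "\<dots> \<le> exp (L * ?\<eta>)" using \<eta> m by (simp only: exp_le_cancel_iff) (intro mult_right_mono, auto)
    finally show "(1 + ?\<eta>) ^ m \<le> exp (2 * L ^ 2 / (real n * real d))"
      by (simp add: power2_eq_square mult_ac)
    have "fact m / L ^ m \<le> real m ^ (m + 1) * exp (1 - real m) / L ^ m"
      using fact_le_power_exp[OF m(3)] L2 by (intro divide_right_mono) auto
    also have "\<dots> = real m * exp (1 - real m) * (real m / L) ^ m" by (simp add: power_divide)
    also have "\<dots> \<le> real m * exp (1 - real m) * 1"
      using m L2 by (intro mult_left_mono power_le_one) auto
    \<comment> \<open>\<open>L \<le> m + 2\<close> bounds the exponent \<open>1 - m\<close> by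
      \<open>3 - L\<close>.\<close>
    also have "\<dots> \<le> L * exp (3 - L)" unfolding mult_1_right using m by (intro mult_mono) auto
    finally show "fact m / L ^ m \<le> L * exp (3 - L)" .
  qed (use L2 in \<open>auto simp: R_def\<close>)
  also have "\<dots> = L * exp (2 * L ^ 2 / (real n * real d) + 3 - L) * R"
    by (simp add: exp_add[symmetric] mult_ac add_diff_eq)
  finally show ?thesis by (simp add: w_def R_def)
qed

section \<open>Union bound over pairs of sets\<close>

lemma card_has_bip_hole_le:
  assumes bound: "\<And>A B. A \<subseteq> {0..<n} \<Longrightarrow> card A = q \<Longrightarrow> B \<subseteq> {0..<n} \<Longrightarrow> card B = q \<Longrightarrow> A \<inter> B = {}
      \<Longrightarrow> real (card (graphs_with_cross n d A B 0)) \<le> K"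
    and K: "K \<ge> 0"
  shows "real (card {G \<in> regular_graphs n d. has_bip_hole n G q}) \<le> real (n choose q) ^ 2 * K"
proof -
  define S where "S = {A. A \<subseteq> {0..<n} \<and> card A = q}"
  define P where "P = {p \<in> S \<times> S. fst p \<inter> snd p = {}}"
  have finS: "finite S" unfolding S_def by simp
  then have finP: "finite P" unfolding P_def by simp
  have "card P \<le> card (S \<times> S)" unfolding P_def using finS by (intro card_mono) auto
  also have "\<dots> = (n choose q) ^ 2"
    using n_subsets[of "{0..<n}" q] by (simp add: card_cartesian_product S_def power2_eq_square)
  finally have cP: "card P \<le> (n choose q) ^ 2" .
  have "{G \<in> regular_graphs n d. has_bip_hole n G q} \<subseteq> (\<Union>p\<in>P. graphs_with_cross n d (fst p) (snd p) 0)"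
  proof
    fix G assume G: "G \<in> {G \<in> regular_graphs n d. has_bip_hole n G q}"
    then obtain A B where h: "bip_hole n G q A B" by (auto simp: has_bip_hole_def)
    then have "cross_pairs A B G = {}" by (auto simp: bip_hole_def cross_pairs_def)
    then have "G \<in> graphs_with_cross n d A B 0" using G by (simp add: graphs_with_cross_def)
    moreover have "(A, B) \<in> P" using h by (auto simp: bip_hole_def P_def S_def)
    ultimately show "G \<in> (\<Union>p\<in>P. graphs_with_cross n d (fst p) (snd p) 0)" by force
  qed
  then have "card {G \<in> regular_graphs n d. has_bip_hole n G q}
      \<le> card (\<Union>p\<in>P. graphs_with_cross n d (fst p) (snd p) 0)"
    by (intro card_mono) (auto simp: finP graphs_with_cross_def finite_regular_graphs)
  also have "\<dots> \<le> (\<Sum>p\<in>P. card (graphs_with_cross n d (fst p) (snd p) 0))"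
    by (rule card_UN_le[OF finP])
  finally have "real (card {G \<in> regular_graphs n d. has_bip_hole n G q})
      \<le> (\<Sum>p\<in>P. real (card (graphs_with_cross n d (fst p) (snd p) 0)))"
    unfolding of_nat_sum[symmetric] by (rule of_nat_mono)
  also have "\<dots> \<le> (\<Sum>p\<in>P. K)"
    by (intro sum_mono bound) (auto simp: P_def S_def)
  also have "\<dots> \<le> real (n choose q) ^ 2 * K"
    using mult_right_mono[OF of_nat_mono[OF cP] K] by simp
  finally show ?thesis .
qed

text \<open>
  With \<open>\<mu> = q\<^sup>2 d / n\<close>, the expected number of edges between two \<open>q\<close>-sets, the union bound has exponent
  at most \<open>2 q ln d - (1 - 2 \<tau>) \<mu>\<close>, and \<open>\<tau>\<close> is chosen so that \<open>(1 - 2 \<tau>) (1 + \<epsilon>) = 1 + \<epsilon> / 2\<close>.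
\<close>

lemma card_has_bip_hole_exp_le:
  fixes \<epsilon> \<tau> :: real
  assumes \<epsilon>: "\<epsilon> > 0" and \<tau>: "\<tau> = \<epsilon> / (4 * (1 + \<epsilon>))"
    and d: "ln (real d) \<ge> 2" and q: "2 \<le> q" "q \<le> n"
    and lower: "2 * (1 + \<epsilon>) * ln (real d) / real d \<le> real q / real n"
    and small: "2 * real q / real n + 3 * real d / real q \<le> \<tau>"
  shows "real (card {G \<in> regular_graphs n d. has_bip_hole n G q})
    \<le> real q * real d * exp (3 - \<epsilon> * real q) * real (card (regular_graphs n d))"
proof -
  define R where "R = real (card (regular_graphs n d))"
  define \<theta> where "\<theta> = 2 * real q / real n + 3 * real d / real q"
  define \<mu> where "\<mu> = real q ^ 2 * real d / real n"
  define L where "L = (1 - \<theta>) * \<mu>"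
  have \<tau>14: "0 < \<tau>" "\<tau> < 1/4" and \<tau>\<epsilon>: "(1 - 2 * \<tau>) * (1 + \<epsilon>) = 1 + \<epsilon> / 2"
    using \<epsilon> by (simp_all add: \<tau> field_simps)
  have d0: "0 < d" using d by (cases d) auto
  have n0: "0 < n" using q by simp
  have \<theta>: "0 \<le> \<theta>" "\<theta> \<le> \<tau>" using small by (auto simp: \<theta>_def)
  have \<mu>lower: "2 * (1 + \<epsilon>) * real q * ln (real d) \<le> \<mu>"
  proof -
    have "(2 * (1 + \<epsilon>) * ln (real d) / real d) * (real q * real d) \<le> (real q / real n) * (real q * real d)"
      by (intro mult_right_mono lower) auto
    then show ?thesis using d0 by (simp add: \<mu>_def power2_eq_square mult_ac)
  qed
  have qln: "real q \<le> real q * ln (real d)" using d q by simp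
  have "2 * (real q * ln (real d)) \<le> 2 * (1 + \<epsilon>) * real q * ln (real d)"
    using \<epsilon> d by (simp add: algebra_simps)
  then have \<mu>4: "4 \<le> \<mu>" using \<mu>lower qln q by linarith
  have "(3/4) * \<mu> \<le> L" unfolding L_def using \<theta> \<tau>14 \<mu>4 by (intro mult_right_mono) auto
  then have L2: "2 \<le> L" using \<mu>4 by linarith
  have L\<mu>: "L \<le> \<mu>" unfolding L_def using \<theta> \<tau>14 \<mu>4 by (intro mult_left_le_one_le) auto
  \<comment> \<open>The exponent loses \<open>\<tau> * \<mu>\<close> twice: here, from
    \<open>L\<close> against \<open>\<mu>\<close>, and in \<open>quad\<close>, from the factor
    \<open>(1 + 2 L / M)^m\<close> of the recursion.\<close>
  have L\<tau>: "(1 - \<tau>) * \<mu> \<le> L" unfolding L_def using \<theta> \<mu>4 by (intro mult_right_mono) auto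
  have qn1: "real q / real n \<le> 1" using q n0 by simp
  have \<mu>qd: "\<mu> \<le> real q * real d"
    using mult_right_mono[OF qn1, of "real q * real d"] by (simp add: \<mu>_def power2_eq_square mult_ac)
  have quad: "2 * L ^ 2 / (real n * real d) \<le> \<tau> * \<mu>"
  proof -
    have "L ^ 2 \<le> \<mu> ^ 2" using L2 L\<mu> by (intro power_mono) auto
    then have "2 * L ^ 2 / (real n * real d) \<le> 2 * \<mu> ^ 2 / (real n * real d)"
      by (intro divide_right_mono) auto
    also have "\<dots> = 2 * (real q / real n) * (real q / real n) * \<mu>"
      using n0 d0 by (simp add: \<mu>_def field_simps power2_eq_square)
    also have "\<dots> \<le> \<tau> * 1 * \<mu>"
    proof (intro mult_right_mono mult_mono)
      have "0 \<le> 3 * real d / real q" by simp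
      then have "2 * real q / real n \<le> \<tau>" using small by linarith
      then show "2 * (real q / real n) \<le> \<tau>" by simp
    qed (use \<tau>14 qn1 \<mu>4 in auto)
    finally show ?thesis by simp
  qed
  \<comment> \<open>As \<open>e \<le> 3 \<le> 2 (1 + \<epsilon>) ln d\<close>, the hypothesis
    \<open>lower\<close> gives \<open>q / n \<ge> e / d\<close>. The 1 gained cancels the 1 in the
    binomial bound, so each set costs at most a factor \<open>d^q\<close>.\<close>
  have lnnq: "ln (real n / real q) \<le> ln (real d) - 1"
  proof -
    have "exp 1 \<le> (3::real)" by (rule exp_le)
    also have "3 \<le> 2 * (1 + \<epsilon>) * ln (real d)"
    proof -
      have "2 * 2 \<le> 2 * (1 + \<epsilon>) * ln (real d)" using \<epsilon> d by (intro mult_mono) auto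
      then show ?thesis by simp
    qed
    finally have "exp 1 / real d \<le> 2 * (1 + \<epsilon>) * ln (real d) / real d" by (intro divide_right_mono) auto
    then have "exp 1 / real d \<le> real q / real n" using lower by linarith
    then have "ln (exp 1 / real d) \<le> ln (real q / real n)" using d0 q n0 by (subst ln_le_cancel_iff) auto
    then show ?thesis using d0 q n0 by (simp add: ln_div)
  qed
  have "real (card {G \<in> regular_graphs n d. has_bip_hole n G q})
      \<le> real (n choose q) ^ 2 * (L * exp (2 * L ^ 2 / (real n * real d) + 3 - L) * R)"
  proof (rule card_has_bip_hole_le)
    show "0 \<le> L * exp (2 * L ^ 2 / (real n * real d) + 3 - L) * R" using L2 by (simp add: R_def)
    fix A B assume AB: "A \<subseteq> {0..<n}" "card A = q" "B \<subseteq> {0..<n}" "card B = q" "A \<inter> B = {}"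
    show "real (card (graphs_with_cross n d A B 0)) \<le> L * exp (2 * L ^ 2 / (real n * real d) + 3 - L) * R"
      unfolding R_def
      by (rule card_graphs_with_cross_0_le[OF AB])
        (use q d0 L2 in \<open>auto simp: L_def \<theta>_def \<mu>_def algebra_simps\<close>)
  qed
  also have "\<dots> \<le> exp (real q * ln (real d)) ^ 2 * (real q * real d * exp (\<tau> * \<mu> + 3 - (1 - \<tau>) * \<mu>) * R)"
  proof (intro mult_mono power_mono)
    have "real (n choose q) \<le> exp (real q * (1 + ln (real n / real q)))"
      using q by (intro binomial_le_exp_ln) auto
    also have "\<dots> \<le> exp (real q * ln (real d))"
      using lnnq by (simp only: exp_le_cancel_iff) (intro mult_left_mono, auto)
    finally show "real (n choose q) \<le> exp (real q * ln (real d))" .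
    show "exp (2 * L ^ 2 / (real n * real d) + 3 - L) \<le> exp (\<tau> * \<mu> + 3 - (1 - \<tau>) * \<mu>)"
      using quad L\<tau> by simp
  qed (use L\<mu> \<mu>qd L2 in \<open>auto simp: R_def\<close>)
  also have "\<dots> = real q * real d * exp (2 * (real q * ln (real d)) + 3 - (1 - 2 * \<tau>) * \<mu>) * R"
  proof -
    have "2 * (real q * ln (real d)) + 3 - (1 - 2 * \<tau>) * \<mu>
        = (real q * ln (real d) + real q * ln (real d)) + (\<tau> * \<mu> + 3 - (1 - \<tau>) * \<mu>)"
      by (simp add: algebra_simps)
    then show ?thesis by (simp only: exp_add power2_eq_square mult_ac)
  qed
  also have "\<dots> \<le> real q * real d * exp (3 - \<epsilon> * real q) * R"
  proof (intro mult_right_mono mult_left_mono)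
    have "(1 - 2 * \<tau>) * (2 * (1 + \<epsilon>) * real q * ln (real d)) \<le> (1 - 2 * \<tau>) * \<mu>"
      using \<tau>14 by (intro mult_left_mono \<mu>lower) auto
    also have "(1 - 2 * \<tau>) * (2 * (1 + \<epsilon>) * real q * ln (real d))
        = ((1 - 2 * \<tau>) * (1 + \<epsilon>)) * (2 * (real q * ln (real d)))" by (simp only: mult_ac)
    also have "\<dots> = 2 * (real q * ln (real d)) + \<epsilon> * (real q * ln (real d))"
      unfolding \<tau>\<epsilon> by (simp add: algebra_simps)
    finally have "2 * (real q * ln (real d)) + \<epsilon> * (real q * ln (real d)) \<le> (1 - 2 * \<tau>) * \<mu>" .
    moreover have "\<epsilon> * real q \<le> \<epsilon> * (real q * ln (real d))" using qln \<epsilon> by (intro mult_left_mono) auto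
    ultimately show "exp (2 * (real q * ln (real d)) + 3 - (1 - 2 * \<tau>) * \<mu>) \<le> exp (3 - \<epsilon> * real q)"
      by simp
  qed (auto simp: R_def)
  finally show ?thesis by (simp add: R_def)
qed

text \<open>Only decay of order \<open>1 / q\<close> is kept, from the quadratic Taylor term of
  \<open>exp\<close>; this allows an explicit threshold for \<open>n\<close>.\<close>

lemma mult_exp_minus_le:
  fixes q \<epsilon> :: real
  assumes "q > 0" "\<epsilon> > 0"
  shows "q * exp (3 - \<epsilon> * q) \<le> 2 * exp 3 / (\<epsilon>\<^sup>2 * q)"
proof -
  have "(\<epsilon> * q)\<^sup>2 / 2 \<le> exp (\<epsilon> * q)"
    using exp_lower_Taylor_quadratic[of "\<epsilon> * q"] assms mult_pos_pos[of \<epsilon> q] by linarith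
  then have "q * exp 3 * ((\<epsilon> * q)\<^sup>2 / 2) \<le> q * exp 3 * exp (\<epsilon> * q)"
    using assms by (intro mult_left_mono) auto
  then show ?thesis using assms by (simp add: exp_diff field_simps power2_eq_square)
qed

section \<open>Passage to asymptotic statements\<close>

lemma prob_reg_ge_complement:
  assumes "regular_graphs n d \<noteq> {}"
    and "real (card {G \<in> regular_graphs n d. \<not> P n G}) \<le> \<delta> * real (card (regular_graphs n d))"
  shows "prob_reg n d P \<ge> 1 - \<delta>"
proof -
  let ?R = "regular_graphs n d"
  have pos: "0 < real (card ?R)" using assms(1) finite_regular_graphs by (simp add: card_gt_0_iff)
  have "?R = {G \<in> ?R. P n G} \<union> {G \<in> ?R. \<not> P n G}" by blast
  then have "card ?R = card {G \<in> ?R. P n G} + card {G \<in> ?R. \<not> P n G}"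
    using finite_regular_graphs[of n d]
    by (metis (no_types, lifting) card_Un_disjoint finite_Un disjoint_iff mem_Collect_eq)
  then have "(1 - \<delta>) * real (card ?R) \<le> real (card {G \<in> ?R. P n G})"
    using assms(2) by (simp add: algebra_simps)
  then show ?thesis using pos by (simp add: prob_reg_def pos_le_divide_eq)
qed

text \<open>By monotonicity only the size \<open>q = \<lceil>t n\<rceil>\<close> has to be excluded,
  where \<open>t n\<close> is the threshold. The hypothesis \<open>small\<close> says
  \<open>t \<le> \<tau> / 8\<close>, which with \<open>q \<le> 2 t n\<close> gives
  \<open>2 q / n \<le> \<tau> / 2\<close>.\<close>

lemma aas_no_bip_hole:
  fixes \<epsilon> :: real
  assumes \<epsilon>: "\<epsilon> > 0" and d: "ln (real d) \<ge> 2"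
    and small: "2 * (1 + \<epsilon>) * (ln (real d) / real d) \<le> \<epsilon> / (32 * (1 + \<epsilon>))"
  shows "aas d (\<lambda>n G. \<forall>q::nat. real q \<ge> (1 + \<epsilon>) * 2 * real n * ln (real d) / real d
                          \<longrightarrow> \<not> has_bip_hole n G q)"
  unfolding aas_def
proof (intro allI impI)
  fix \<delta> :: real assume \<delta>: "\<delta> > 0"
  define t where "t = 2 * (1 + \<epsilon>) * ln (real d) / real d"
  define \<tau> where "\<tau> = \<epsilon> / (4 * (1 + \<epsilon>))"
  have d0: "0 < d" using d by (cases d) auto
  have "0 < 2 * (1 + \<epsilon>) * ln (real d)" using \<epsilon> d by (intro mult_pos_pos) auto
  then have t: "0 < t" "t \<le> \<tau> / 8" using d0 small by (simp_all add: t_def \<tau>_def)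
  have \<tau>: "0 < \<tau>" "\<tau> < 1/4" using \<epsilon> by (simp_all add: \<tau>_def field_simps)
  \<comment> \<open>In order: regular graphs exist; \<open>q \<ge> 2\<close> and rounding up at most
    doubles \<open>t n\<close>; \<open>3 d / q \<le> \<tau> / 2\<close>; the failure probability is
    at most \<open>\<delta>\<close>.\<close>
  define N where "N = Max {d + 1, nat \<lceil>2 / t\<rceil>, nat \<lceil>6 * real d / \<tau> / t\<rceil>, nat \<lceil>2 * exp 3 * real d / (\<epsilon>\<^sup>2 * \<delta>) / t\<rceil>}"
  show "\<exists>N. \<forall>n\<ge>N. even (n * d) \<longrightarrow> 1 - \<delta> \<le> prob_reg n d (\<lambda>n G. \<forall>q::nat.
      real q \<ge> (1 + \<epsilon>) * 2 * real n * ln (real d) / real d \<longrightarrow> \<not> has_bip_hole n G q)"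
  proof (intro exI allI impI)
    fix n assume nN: "n \<ge> N" and ev: "even (n * d)"
    have "n \<ge> d + 1" and "n \<ge> nat \<lceil>2 / t\<rceil>" and "n \<ge> nat \<lceil>6 * real d / \<tau> / t\<rceil>"
      and "n \<ge> nat \<lceil>2 * exp 3 * real d / (\<epsilon>\<^sup>2 * \<delta>) / t\<rceil>"
      using nN unfolding N_def by simp_all
    then have n: "d < n" "2 / t \<le> real n" "6 * real d / \<tau> / t \<le> real n"
        "2 * exp 3 * real d / (\<epsilon>\<^sup>2 * \<delta>) / t \<le> real n"
      by linarith+
    have n': "2 \<le> t * real n" "6 * real d / \<tau> \<le> t * real n"
        "2 * exp 3 * real d / (\<epsilon>\<^sup>2 * \<delta>) \<le> t * real n"
      using n(2-) t(1) by (simp_all only: pos_divide_le_eq mult.commute)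
    define q where "q = nat \<lceil>t * real n\<rceil>"
    have q1: "t * real n \<le> real q" unfolding q_def by linarith
    have q2: "real q \<le> 2 * (t * real n)" unfolding q_def using n'(1) by linarith
    have n0: "0 < real n" using n(1) by simp
    have q0: "2 \<le> q" using q1 n'(1) by linarith
    have qt: "t \<le> real q / real n" "real q / real n \<le> 2 * t" using q1 q2 n0 by (simp_all add: field_simps)
    have "real q / real n \<le> 1" using qt t \<tau> by linarith
    then have qn: "q \<le> n" using n0 by simp
    have "6 * real d / \<tau> \<le> real q" using n'(2) q1 by linarith
    then have "3 * real d / real q \<le> \<tau> / 2" using \<tau> q0 by (simp add: field_simps)
    moreover have "2 * real q / real n \<le> \<tau> / 2" using qt t by simp
    ultimately have sm: "2 * real q / real n + 3 * real d / real q \<le> \<tau>" by linarith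
    have "real (card {G \<in> regular_graphs n d. has_bip_hole n G q})
        \<le> real q * real d * exp (3 - \<epsilon> * real q) * real (card (regular_graphs n d))"
      using card_has_bip_hole_exp_le[OF \<epsilon> \<tau>_def d q0 qn _ sm] qt by (simp add: t_def)
    also have "\<dots> \<le> \<delta> * real (card (regular_graphs n d))"
    proof (rule mult_right_mono)
      have "real q * exp (3 - \<epsilon> * real q) * real d \<le> 2 * exp 3 / (\<epsilon>\<^sup>2 * real q) * real d"
        using q0 \<epsilon> by (intro mult_right_mono mult_exp_minus_le) auto
      also have "\<dots> \<le> \<delta>"
      proof -
        have "2 * exp 3 * real d / (\<epsilon>\<^sup>2 * \<delta>) \<le> real q" using n'(3) q1 by linarith
        then show ?thesis using \<epsilon> \<delta> q0 by (simp add: field_simps)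
      qed
      finally show "real q * real d * exp (3 - \<epsilon> * real q) \<le> \<delta>" by (simp only: mult_ac)
    qed simp
    finally have bad: "real (card {G \<in> regular_graphs n d. has_bip_hole n G q})
        \<le> \<delta> * real (card (regular_graphs n d))" .
    show "1 - \<delta> \<le> prob_reg n d (\<lambda>n G. \<forall>q::nat.
      real q \<ge> (1 + \<epsilon>) * 2 * real n * ln (real d) / real d \<longrightarrow> \<not> has_bip_hole n G q)"
    proof (rule prob_reg_ge_complement)
      show "regular_graphs n d \<noteq> {}" by (rule regular_graphs_nonempty[OF n(1) ev])
      have "q \<le> p" if "real p \<ge> (1 + \<epsilon>) * 2 * real n * ln (real d) / real d" for p
      proof -
        have "t * real n \<le> real p" using that by (simp add: t_def mult_ac)
        then show ?thesis unfolding q_def by linarith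
      qed
      then have "{G \<in> regular_graphs n d. \<not> (\<forall>q::nat.
          real q \<ge> (1 + \<epsilon>) * 2 * real n * ln (real d) / real d \<longrightarrow> \<not> has_bip_hole n G q)}
          \<subseteq> {G \<in> regular_graphs n d. has_bip_hole n G q}"
        using has_bip_hole_mono by blast
      then have "card {G \<in> regular_graphs n d. \<not> (\<forall>q::nat.
          real q \<ge> (1 + \<epsilon>) * 2 * real n * ln (real d) / real d \<longrightarrow> \<not> has_bip_hole n G q)}
          \<le> card {G \<in> regular_graphs n d. has_bip_hole n G q}"
        using finite_regular_graphs by (intro card_mono) auto
      with bad show "real (card {G \<in> regular_graphs n d. \<not> (\<forall>q::nat.
          real q \<ge> (1 + \<epsilon>) * 2 * real n * ln (real d) / real d \<longrightarrow> \<not> has_bip_hole n G q)})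
          \<le> \<delta> * real (card (regular_graphs n d))" by linarith
    qed
  qed
qed

text \<open>The implication is required for large \<open>n\<close> only, which leaves room for
  rounding.\<close>

lemma aas_mono:
  assumes "aas d P" and imp: "\<And>n G. n \<ge> N0 \<Longrightarrow> P n G \<Longrightarrow> Q n G"
  shows "aas d Q"
  unfolding aas_def
proof (intro allI impI)
  fix \<delta> :: real assume "\<delta> > 0"
  then obtain N where N: "\<And>n. n \<ge> N \<Longrightarrow> even (n * d) \<Longrightarrow> prob_reg n d P \<ge> 1 - \<delta>"
    using assms(1) unfolding aas_def by blast
  have "prob_reg n d Q \<ge> 1 - \<delta>" if n: "n \<ge> max N N0" "even (n * d)" for n
  proof -
    have "card {G \<in> regular_graphs n d. P n G} \<le> card {G \<in> regular_graphs n d. Q n G}"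
      using imp n finite_regular_graphs by (intro card_mono) auto
    then have "prob_reg n d P \<le> prob_reg n d Q"
      unfolding prob_reg_def by (intro divide_right_mono) auto
    then show ?thesis using N[of n] n by simp
  qed
  then show "\<exists>N. \<forall>n\<ge>N. even (n * d) \<longrightarrow> prob_reg n d Q \<ge> 1 - \<delta>" by blast
qed

text \<open>The gap between \<open>s\<close> and \<open>t\<close> absorbs the rounding in \<open>(n - z) div 2\<close>.\<close>

lemma aas_zero_forcing_number_ge:
  fixes s t :: real
  assumes "aas d (\<lambda>n G. \<forall>q::nat. real q \<ge> s * real n \<longrightarrow> \<not> has_bip_hole n G q)" "0 \<le> s" "s < t"
  shows "aas d (\<lambda>n G. real (zero_forcing_number n G) \<ge> real n * (1 - 2 * t))"
proof (rule aas_mono[OF assms(1)])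
  fix n G
  assume n: "n \<ge> nat \<lceil>1 / (t - s)\<rceil>"
    and nohole: "\<forall>q::nat. real q \<ge> s * real n \<longrightarrow> \<not> has_bip_hole n G q"
  define z where "z = zero_forcing_number n G"
  obtain B where B: "zero_forcing_set n G B" "card B = z"
    using zero_forcing_set_zero_forcing_number z_def by blast
  have "1 / (t - s) \<le> real n" using n by linarith
  then have n1: "1 \<le> t * real n - s * real n" using assms(3) by (simp add: field_simps)
  show "real (zero_forcing_number n G) \<ge> real n * (1 - 2 * t)"
  proof (rule ccontr)
    assume "\<not> ?thesis"
    then have lt: "real z < real n - 2 * (t * real n)" by (simp add: z_def algebra_simps)
    \<comment> \<open>Together with \<open>n1\<close> this gives \<open>t n > 0\<close>, hence
      \<open>z \<le> n\<close>, so the natural subtraction \<open>n - z\<close> is not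
      truncated.\<close>
    have "0 \<le> s * real n" using assms(2) by simp
    with lt n1 have zn: "z \<le> n" by linarith
    let ?p = "(n - z) div 2"
    have "n - z \<le> 2 * ?p + 1" by simp
    then have "real n - real z \<le> 2 * real ?p + 1" using zn by linarith
    then have "s * real n \<le> real ?p" using lt n1 by linarith
    moreover have "has_bip_hole n G ?p"
      using zn B by (intro zero_forcing_set_imp_bip_hole[of n G B]) auto
    ultimately show False using nohole by blast
  qed
qed

theorem mainTheorem2:
  fixes \<epsilon> :: real
  assumes "\<epsilon> > 0"
  shows "\<exists>d0::nat. \<forall>d\<ge>d0.
     aas d (\<lambda>n G. \<forall>q::nat. real q \<ge> (1 + \<epsilon>) * 2 * real n * ln (real d) / real d
                          \<longrightarrow> \<not> has_bip_hole n G q)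
   \<and> aas d (\<lambda>n G. real (zero_forcing_number n G)
                    \<ge> real n * (1 - (1 + \<epsilon>) * 4 * ln (real d) / real d))"
proof -
  have small: "\<forall>\<^sub>F d::nat in sequentially.
      2 * (1 + \<eta>) * (ln (real d) / real d) \<le> \<eta> / (32 * (1 + \<eta>))" if \<eta>: "\<eta> > 0" for \<eta> :: real
  proof -
    have "((\<lambda>d::nat. ln (real d) / real d) \<longlongrightarrow> 0) sequentially"
      by (rule filterlim_compose[OF ln_x_over_x_tendsto_0 filterlim_real_sequentially])
    then have "((\<lambda>d::nat. 2 * (1 + \<eta>) * (ln (real d) / real d)) \<longlongrightarrow> 2 * (1 + \<eta>) * 0) sequentially"
      by (intro tendsto_intros)
    then have "\<forall>\<^sub>F d::nat in sequentially. 2 * (1 + \<eta>) * (ln (real d) / real d) < \<eta> / (32 * (1 + \<eta>))"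
      using \<eta> by (intro order_tendstoD) auto
    then show ?thesis by (rule eventually_mono) simp
  qed
  have "filterlim (\<lambda>d::nat. ln (real d)) at_top sequentially"
    by (rule filterlim_compose[OF ln_at_top filterlim_real_sequentially])
  then have "\<forall>\<^sub>F d::nat in sequentially. 2 \<le> ln (real d)" by (simp add: filterlim_at_top)
  then have "\<forall>\<^sub>F d::nat in sequentially. 2 \<le> ln (real d)
      \<and> 2 * (1 + \<epsilon>) * (ln (real d) / real d) \<le> \<epsilon> / (32 * (1 + \<epsilon>))
      \<and> 2 * (1 + \<epsilon> / 2) * (ln (real d) / real d) \<le> (\<epsilon> / 2) / (32 * (1 + \<epsilon> / 2))"
    using small[of \<epsilon>] small[of "\<epsilon> / 2"] assms by (simp add: eventually_conj_iff)
  then obtain d0 where d0: "\<And>d. d \<ge> d0 \<Longrightarrow> 2 \<le> ln (real d)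
      \<and> 2 * (1 + \<epsilon>) * (ln (real d) / real d) \<le> \<epsilon> / (32 * (1 + \<epsilon>))
      \<and> 2 * (1 + \<epsilon> / 2) * (ln (real d) / real d) \<le> (\<epsilon> / 2) / (32 * (1 + \<epsilon> / 2))"
    unfolding eventually_sequentially by blast
  show ?thesis
  proof (intro exI allI impI conjI)
    fix d assume "d \<ge> d0"
    note d = d0[OF this]
    show "aas d (\<lambda>n G. \<forall>q::nat. real q \<ge> (1 + \<epsilon>) * 2 * real n * ln (real d) / real d
        \<longrightarrow> \<not> has_bip_hole n G q)"
      using d assms by (intro aas_no_bip_hole) auto
    have pos: "0 < ln (real d)" "0 < real d" using d by (auto intro: gr0I)
    \<comment> \<open>Holes are excluded already at \<open>\<epsilon> / 2\<close>, which provides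
      the strict gap \<open>s < t\<close> needed for zero forcing; the constant 4 is twice the 2 of
      the hole bound.\<close>
    have "aas d (\<lambda>n G. \<forall>q::nat. real q \<ge> (1 + \<epsilon> / 2) * 2 * real n * ln (real d) / real d
        \<longrightarrow> \<not> has_bip_hole n G q)"
      using d assms by (intro aas_no_bip_hole) auto
    then have "aas d (\<lambda>n G. \<forall>q::nat. real q \<ge> ((1 + \<epsilon> / 2) * 2 * ln (real d) / real d) * real n
        \<longrightarrow> \<not> has_bip_hole n G q)"
      by (simp add: mult_ac)
    then have "aas d (\<lambda>n G. real (zero_forcing_number n G)
        \<ge> real n * (1 - 2 * ((1 + \<epsilon>) * 2 * ln (real d) / real d)))"
      by (rule aas_zero_forcing_number_ge) (use pos assms in \<open>auto intro!: divide_strict_right_mono\<close>)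
    then show "aas d (\<lambda>n G. real (zero_forcing_number n G)
        \<ge> real n * (1 - (1 + \<epsilon>) * 4 * ln (real d) / real d))"
      by (simp add: algebra_simps)
  qed
qed

end
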